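(* If $\Gamma\Rightarrow C$ is derivable in $\mathsf{G0T}^{i}$, then there is a fully normal derivation $\mathcal D$ in $\mathsf{NgT}^{i}$ with $\mathrm{oa}(\mathcal D)\sqsubseteq\Gamma$ and $\mathrm{end}(\mathcal D)=C$.
   Context: Formulae are generated from a countable set of propositional variables by $A ::= p \mid \bot \mid A\land A \mid A\lor A \mid A\to A$. The calculus $\mathsf{G0T}^{i}$ (rules written premisses / conclusion). Sequents $\Gamma\Rightarrow C$ with $\Gamma$ a finite multiset and $C$ a formula. Initial sequents: $A\Rightarrow A$ and $\bot\Rightarrow C$ for arbitrary formulae $A,C$. Structural rules: weakening $\Gamma\Rightarrow C$ / $A,\Gamma\Rightarrow C$; contraction $A,A,\Gamma\Rightarrow C$ / $A,\Gamma\Rightarrow C$. Operational rules: - $A,B,\Gamma\Rightarrow C$ / $A\land B,\Gamma\Rightarrow C$. - $A,\Gamma\Rightarrow C$ and $B,\Delta\Rightarrow C$ / $A\lor B,\Gamma,\Delta\Rightarrow C$. - $\Gamma\Rightarrow A$ and $B,\Delta\Rightarrow C$ / $A\to B,\Gamma,\Delta\Rightarrow C$. - $\Gamma\Rightarrow A$ and $\Delta\Rightarrow B$ / $\Gamma,\Delta\Rightarrow A\land B$. - $\Gamma\Rightarrow A$ / $\Gamma\Rightarrow A\lor B$; and $\Gamma\Rightarrow B$ / $\Gamma\Rightarrow A\lor B$. - $A,\Gamma\Rightarrow B$ / $\Gamma\Rightarrow A\to B$. The natural deduction system $\mathsf{NgT}^{i}$. A derivation is a finite tree of formulae grown by the rules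 below; its topmost formulae are assumptions, each open or discharged by an application of a rule further down. $\mathrm{oa}(\mathcal D)$ is the multiset of open assumptions of $\mathcal D$ and $\mathrm{end}(\mathcal D)$ its end-formula. A single assumption $A$ is a derivation with open assumptions $\{A\}$ and end-formula $A$. A rule that discharges an assumption formula in a subderivation discharges all its open occurrences there; there may be zero (vacuous discharge), one, or several. - $\land\mathrm I$: from $A$ and $B$ infer $A\land B$. - $\lor\mathrm I_1$: from $A$ infer $A\lor B$. $\lor\mathrm I_2$: from $B$ infer $A\lor B$. - $\to\!\mathrm I$: from a derivation of $B$, infer $A\to B$, discharging $A$. - $\land\mathrm E$: from a major premiss $A\land B$ and a minor derivation of $C$, infer $C$, discharging $A$ and $B$ in the minor derivation. - $\lor\mathrm E$: from a major premiss $A\lor B$ and two minor derivations of $C$, infer $C$, discharging $A$ in the first minor derivation and $B$ in the second. - $\to\!\mathrm E$: from a major premiss $A\to B$, a minor derivation of $A$ (no discharge) and a minor derivation of $C$, infer $C$, discharging $B$ in the latter. - $\bot\mathrm E$: from the (major) premiss $\bot$ infer any formula $C$. A derivation is fully normal if the major premiss of every application of an elimination rule (including the premiss $\bot$ of every application of $\bot\mathrm E$) is an assumption, open or discharged. For multisets, $\Theta\sqsubseteq\Gamma$ ($\Theta$ is subsumed by $\Gamma$) means that every formula occurring in $\Theta$ occurs in $\Gamma$ (multiplicities are ignored). *)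

theory Defs
  imports "HOL-Library.Multiset" "HOL-Library.Countable"
begin

datatype 'v formula =
    Var 'v
  | Bot ("\<^bold>\<bottom>")
  | Conj "'v formula" "'v formula" (infixr "\<^bold>\<and>" 75)
  | Disj "'v formula" "'v formula" (infixr "\<^bold>\<or>" 70)
  | Imp "'v formula" "'v formula" (infixr "\<^bold>\<rightarrow>" 65)

text \<open>Derivability in G0Ti: \<open>\<Gamma> \<turnstile> C\<close> says that the sequent \<open>\<Gamma> \<Rightarrow> C\<close> is derivable.\<close>

inductive G0Ti :: "'v formula multiset \<Rightarrow> 'v formula \<Rightarrow> bool" (infix "\<turnstile>" 45) where
  Init: "{#A#} \<turnstile> A"
| InitBot: "{#\<^bold>\<bottom>#} \<turnstile> C"
| Weakening: "\<Gamma> \<turnstile> C \<Longrightarrow> add_mset A \<Gamma> \<turnstile> C"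
| Contraction: "add_mset A (add_mset A \<Gamma>) \<turnstile> C \<Longrightarrow> add_mset A \<Gamma> \<turnstile> C"
| LConj: "add_mset A (add_mset B \<Gamma>) \<turnstile> C \<Longrightarrow> add_mset (A \<^bold>\<and> B) \<Gamma> \<turnstile> C"
| LDisj: "add_mset A \<Gamma> \<turnstile> C \<Longrightarrow> add_mset B \<Delta> \<turnstile> C \<Longrightarrow> add_mset (A \<^bold>\<or> B) (\<Gamma> + \<Delta>) \<turnstile> C"
| LImp: "\<Gamma> \<turnstile> A \<Longrightarrow> add_mset B \<Delta> \<turnstile> C \<Longrightarrow> add_mset (A \<^bold>\<rightarrow> B) (\<Gamma> + \<Delta>) \<turnstile> C"
| RConj: "\<Gamma> \<turnstile> A \<Longrightarrow> \<Delta> \<turnstile> B \<Longrightarrow> \<Gamma> + \<Delta> \<turnstile> A \<^bold>\<and> B"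
| RDisj1: "\<Gamma> \<turnstile> A \<Longrightarrow> \<Gamma> \<turnstile> A \<^bold>\<or> B"
| RDisj2: "\<Gamma> \<turnstile> B \<Longrightarrow> \<Gamma> \<turnstile> A \<^bold>\<or> B"
| RImp: "add_mset A \<Gamma> \<turnstile> B \<Longrightarrow> \<Gamma> \<turnstile> A \<^bold>\<rightarrow> B"

text \<open>
  Trees built from the rules of NgTi. The formula arguments are those that determine the
  instance of the rule: \<open>ImpI A D\<close> discharges \<open>A\<close> in \<open>D\<close> (all its open occurrences, possibly none),
  \<open>ConjE A B M D\<close> has the major premiss \<open>A \<^bold>\<and> B\<close>, and so on. For the elimination rules
  the derivation of the major premiss comes first. Whether the subtrees have the end-formulae
  demanded by the rules is not enforced by the type but by \<open>derivation\<close> below.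
\<close>

datatype 'v tree =
    is_Assm: Assm "'v formula"
  | ConjI "'v tree" "'v tree"
  | DisjI1 "'v formula" "'v tree"
  | DisjI2 "'v formula" "'v tree"
  | ImpI "'v formula" "'v tree"
  | ConjE "'v formula" "'v formula" "'v tree" "'v tree"
  | DisjE "'v formula" "'v formula" "'v tree" "'v tree" "'v tree"
  | ImpE "'v formula" "'v formula" "'v tree" "'v tree" "'v tree"
  | BotE "'v formula" "'v tree"

primrec end_formula :: "'v tree \<Rightarrow> 'v formula" where
  "end_formula (Assm A) = A"
| "end_formula (ConjI D E) = end_formula D \<^bold>\<and> end_formula E"
| "end_formula (DisjI1 B D) = end_formula D \<^bold>\<or> B"
| "end_formula (DisjI2 A D) = A \<^bold>\<or> end_formula D"
| "end_formula (ImpI A D) = A \<^bold>\<rightarrow> end_formula D"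
| "end_formula (ConjE A B M D) = end_formula D"
| "end_formula (DisjE A B M D E) = end_formula D"
| "end_formula (ImpE A B M D E) = end_formula E"
| "end_formula (BotE C M) = C"

primrec oa :: "'v tree \<Rightarrow> 'v formula multiset" where
  "oa (Assm A) = {#A#}"
| "oa (ConjI D E) = oa D + oa E"
| "oa (DisjI1 B D) = oa D"
| "oa (DisjI2 A D) = oa D"
| "oa (ImpI A D) = {#X \<in># oa D. X \<noteq> A#}"
| "oa (ConjE A B M D) = oa M + {#X \<in># oa D. X \<noteq> A \<and> X \<noteq> B#}"
| "oa (DisjE A B M D E) = oa M + {#X \<in># oa D. X \<noteq> A#} + {#X \<in># oa E. X \<noteq> B#}"
| "oa (ImpE A B M D E) = oa M + oa D + {#X \<in># oa E. X \<noteq> B#}"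
| "oa (BotE C M) = oa M"

primrec derivation :: "'v tree \<Rightarrow> bool" where
  "derivation (Assm A) \<longleftrightarrow> True"
| "derivation (ConjI D E) \<longleftrightarrow> derivation D \<and> derivation E"
| "derivation (DisjI1 B D) \<longleftrightarrow> derivation D"
| "derivation (DisjI2 A D) \<longleftrightarrow> derivation D"
| "derivation (ImpI A D) \<longleftrightarrow> derivation D"
| "derivation (ConjE A B M D) \<longleftrightarrow>
     derivation M \<and> derivation D \<and> end_formula M = A \<^bold>\<and> B"
| "derivation (DisjE A B M D E) \<longleftrightarrow>
     derivation M \<and> derivation D \<and> derivation E \<and>
     end_formula M = A \<^bold>\<or> B \<and> end_formula D = end_formula E"
| "derivation (ImpE A B M D E) \<longleftrightarrow>
     derivation M \<and> derivation D \<and> derivation E \<and>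
     end_formula M = A \<^bold>\<rightarrow> B \<and> end_formula D = A"
| "derivation (BotE C M) \<longleftrightarrow> derivation M \<and> end_formula M = \<^bold>\<bottom>"

text \<open>
  A premiss is an assumption iff its derivation is a leaf; whether that leaf is discharged further
  down is irrelevant.
\<close>

primrec fully_normal :: "'v tree \<Rightarrow> bool" where
  "fully_normal (Assm A) \<longleftrightarrow> True"
| "fully_normal (ConjI D E) \<longleftrightarrow> fully_normal D \<and> fully_normal E"
| "fully_normal (DisjI1 B D) \<longleftrightarrow> fully_normal D"
| "fully_normal (DisjI2 A D) \<longleftrightarrow> fully_normal D"
| "fully_normal (ImpI A D) \<longleftrightarrow> fully_normal D"
| "fully_normal (ConjE A B M D) \<longleftrightarrow> is_Assm M \<and> fully_normal D"
| "fully_normal (DisjE A B M D E) \<longleftrightarrow> is_Assm M \<and> fully_normal D \<and> fully_normal E"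
| "fully_normal (ImpE A B M D E) \<longleftrightarrow> is_Assm M \<and> fully_normal D \<and> fully_normal E"
| "fully_normal (BotE C M) \<longleftrightarrow> is_Assm M"

definition subsumed :: "'v formula multiset \<Rightarrow> 'v formula multiset \<Rightarrow> bool" (infix "\<sqsubseteq>" 50) where
  "\<Theta> \<sqsubseteq> \<Gamma> \<longleftrightarrow> (\<forall>A. A \<in># \<Theta> \<longrightarrow> A \<in># \<Gamma>)"

end

theory Submission
  imports Defs
begin

text \<open>
  A sequent derivation can be read directly as a fully normal natural deduction.
  Right rules are introductions. A left rule acting on a principal formula becomes an elimination
  whose major premiss is a single leaf carrying that formula: the general elimination rules have
  minor derivations with exactly the shape of the premisses of the left rules, so nothing has to be
  substituted into a derivation and no detour or elimination on top of another elimination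
  ever arises. Contraction and weakening leave the natural deduction unchanged, because subsumption
  ignores multiplicities and allows unused formulae in the antecedent. The statement therefore goes
  through by a plain induction on the sequent derivation.
\<close>

theorem theorem6p9:
  fixes \<Gamma> :: "'v::countable formula multiset" and C :: "'v formula"
  assumes "\<Gamma> \<turnstile> C"
  shows "\<exists>D :: 'v tree. derivation D \<and> fully_normal D \<and> oa D \<sqsubseteq> \<Gamma> \<and> end_formula D = C"
  using assms
proof (induction rule: G0Ti.induct)
  case (Init A)
  show ?case by (rule exI[of _ "Assm A"]) (simp add: subsumed_def)
next
  case (InitBot C)
  show ?case by (rule exI[of _ "BotE C (Assm \<^bold>\<bottom>)"]) (simp add: subsumed_def)
next
  case (Weakening \<Gamma> C A)
  then show ?case by (auto simp: subsumed_def)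
next
  case (Contraction A \<Gamma> C)
  then show ?case by (auto simp: subsumed_def)
next
  case (LConj A B \<Gamma> C)
  then obtain D where "derivation D" "fully_normal D"
      "oa D \<sqsubseteq> add_mset A (add_mset B \<Gamma>)" "end_formula D = C"
    by blast
  then show ?case
    by (intro exI[of _ "ConjE A B (Assm (A \<^bold>\<and> B)) D"]) (auto simp: subsumed_def)
next
  case (LDisj A \<Gamma> C B \<Delta>)
  then obtain D E where "derivation D" "fully_normal D" "oa D \<sqsubseteq> add_mset A \<Gamma>" "end_formula D = C"
      and "derivation E" "fully_normal E" "oa E \<sqsubseteq> add_mset B \<Delta>" "end_formula E = C"
    by blast
  then show ?case
    by (intro exI[of _ "DisjE A B (Assm (A \<^bold>\<or> B)) D E"]) (auto simp: subsumed_def)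
next
  case (LImp \<Gamma> A B \<Delta> C)
  then obtain D E where "derivation D" "fully_normal D" "oa D \<sqsubseteq> \<Gamma>" "end_formula D = A"
      and "derivation E" "fully_normal E" "oa E \<sqsubseteq> add_mset B \<Delta>" "end_formula E = C"
    by blast
  then show ?case
    by (intro exI[of _ "ImpE A B (Assm (A \<^bold>\<rightarrow> B)) D E"]) (auto simp: subsumed_def)
next
  case (RConj \<Gamma> A \<Delta> B)
  then obtain D E where "derivation D" "fully_normal D" "oa D \<sqsubseteq> \<Gamma>" "end_formula D = A"
      and "derivation E" "fully_normal E" "oa E \<sqsubseteq> \<Delta>" "end_formula E = B"
    by blast
  then show ?case
    by (intro exI[of _ "ConjI D E"]) (auto simp: subsumed_def)
next
  case (RDisj1 \<Gamma> A B)
  then obtain D where "derivation D" "fully_normal D" "oa D \<sqsubseteq> \<Gamma>" "end_formula D = A"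
    by blast
  then show ?case by (intro exI[of _ "DisjI1 B D"]) simp
next
  case (RDisj2 \<Gamma> B A)
  then obtain D where "derivation D" "fully_normal D" "oa D \<sqsubseteq> \<Gamma>" "end_formula D = B"
    by blast
  then show ?case by (intro exI[of _ "DisjI2 A D"]) simp
next
  case (RImp A \<Gamma> B)
  then obtain D where "derivation D" "fully_normal D" "oa D \<sqsubseteq> add_mset A \<Gamma>" "end_formula D = B"
    by blast
  \<comment> \<open>The rule discharges every open \<open>A\<close> of \<open>D\<close>, even if \<open>A\<close> also occurs in \<open>\<Gamma>\<close>; subsumption
    allows such members of \<open>\<Gamma>\<close> to remain without a matching open assumption.\<close>
  then show ?case by (intro exI[of _ "ImpI A D"]) (auto simp: subsumed_def)
qed

end
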